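(* Let $b>0$, $c>1$ and $m>-1/2$, and let $$p_{\mathrm{McKay\,I}}(x)=\frac{\sqrt{\pi}\,(c^2-1)^{m+1/2}}{2^m b^{m+1}\Gamma(m+1/2)}\,x^m e^{-cx/b}I_m\left(\frac{x}{b}\right),\qquad x>0,$$ be the McKay Type I density. Then $p_{\mathrm{McKay\,I}}$ is log-convex on $(0,\infty)$ if and only if $m\le 0$, and $p_{\mathrm{McKay\,I}}$ is log-concave on $(0,\infty)$ if and only if $m\ge 1/2$.
   Context: $I_m$ denotes the modified Bessel function of the first kind, $I_m(x)=\sum_{k=0}^{\infty}\frac{1}{k!\,\Gamma(k+m+1)}\left(\frac{x}{2}\right)^{2k+m}$ for $x>0$. A positive function $h:J\to(0,\infty)$ on an interval $J\subseteq\mathbb{R}$ is log-convex on $J$ if $h(tx+(1-t)y)\le h(x)^t h(y)^{1-t}$ for all $x,y\in J$, $t\in[0,1]$, and log-concave on $J$ if the reverse inequality holds for all such $x,y,t$. *)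

theory Defs
  imports "HOL-Analysis.Analysis"
begin

text \<open>
  All real powers are written with \<open>powr\<close>, whose bases are positive in the intended range
  of the arguments: \<open>x > 0\<close> for the Bessel function; \<open>b > 0\<close>, \<open>c > 1\<close>, \<open>x > 0\<close> for the density.
\<close>

definition bessel_I :: "real \<Rightarrow> real \<Rightarrow> real" where
  "bessel_I m x =
     (\<Sum>k. 1 / (fact k * Gamma (real k + m + 1)) * (x / 2) powr (2 * real k + m))"

definition mcKay_I_density :: "real \<Rightarrow> real \<Rightarrow> real \<Rightarrow> real \<Rightarrow> real" where
  "mcKay_I_density b c m x =
     sqrt pi * (c\<^sup>2 - 1) powr (m + 1 / 2) / (2 powr m * b powr (m + 1) * Gamma (m + 1 / 2))
     * x powr m * exp (- (c * x / b)) * bessel_I m (x / b)"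

text \<open>Positivity of \<open>h\<close> on the interval \<open>J\<close> is part of both notions.\<close>

definition log_convex_on :: "real set \<Rightarrow> (real \<Rightarrow> real) \<Rightarrow> bool" where
  "log_convex_on J h \<longleftrightarrow> is_interval J \<and> (\<forall>x\<in>J. 0 < h x) \<and>
     (\<forall>x\<in>J. \<forall>y\<in>J. \<forall>t\<in>{0..1}. h (t * x + (1 - t) * y) \<le> h x powr t * h y powr (1 - t))"

definition log_concave_on :: "real set \<Rightarrow> (real \<Rightarrow> real) \<Rightarrow> bool" where
  "log_concave_on J h \<longleftrightarrow> is_interval J \<and> (\<forall>x\<in>J. 0 < h x) \<and>
     (\<forall>x\<in>J. \<forall>y\<in>J. \<forall>t\<in>{0..1}. h (t * x + (1 - t) * y) \<ge> h x powr t * h y powr (1 - t))"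

end

theory Submission
  imports Defs
begin

text \<open>
  Write \<open>I\<^sub>m(x) = (x/2)\<^sup>m \<Phi>\<^sub>m(w)\<close> with \<open>w = (x/2)\<^sup>2\<close> and \<open>\<Phi>\<^sub>m\<close> entire; then \<open>\<Phi>\<^sub>m' = \<Phi>\<^bsub>m+1\<^esub>\<close>, and
  \<open>r = w \<Phi>\<^sub>m' / \<Phi>\<^sub>m\<close> solves the Riccati equation \<open>w r' = w - r\<^sup>2 - m r\<close>. The second derivative of
  the logarithm of the density is a positive multiple of \<open>F = 2w - (2r + 1)(r + m)\<close>, and the Riccati
  equation yields \<open>w F' = F (1/2 - 2r - m) + (r + m)(1/2 - m)\<close>. Since \<open>w\<^bsup>m - 1/2\<^esup> \<Phi>\<^sub>m\<^sup>2\<close> is an integrating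
  factor, the sign of \<open>(r + m)(1/2 - m)\<close> controls that of \<open>F\<close>: for \<open>m \<ge> 1/2\<close> the negative value
  \<open>F(0) = -m\<close> propagates, and for \<open>m \<le> 0\<close> the function cannot become negative, because \<open>F > 0\<close> wherever
  \<open>r + m \<le> 0\<close>. Conversely \<open>F(0) = -m\<close> excludes log-convexity for \<open>m > 0\<close>; and if \<open>F \<le> 0\<close> everywhere
  with \<open>m < 1/2\<close>, then \<open>r\<close> is unbounded, so \<open>F\<close> eventually grows at least like \<open>ln w\<close>, a contradiction.
\<close>

section \<open>Power series of the entire factor of the Bessel function\<close>

text \<open>This is the regularised hypergeometric limit function 0F1(; m + 1; w) / Gamma(m + 1).
  With \<open>rGamma\<close> the coefficients make sense for every real \<open>m\<close>, so the
  shift of \<open>m\<close> in the derivative and the recurrence carry no side conditions.\<close>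

definition bessel_phi :: "real \<Rightarrow> real \<Rightarrow> real" where
  "bessel_phi m w = (\<Sum>k. rGamma (real k + m + 1) / fact k * w ^ k)"

lemma summable_bessel_phi: "summable (\<lambda>k. rGamma (real k + m + 1) / fact k * w ^ k)"
proof (rule summable_ratio_test)
  show "(1 / 2 :: real) < 1" by simp
  fix n :: nat
  \<comment> \<open>From this index on, n + m + 1 \<ge> 1 and (n + 1) / 2 \<ge> |w|, so the ratio
    |w| / ((n + 1) (n + m + 1)) of consecutive terms is at most 1/2.\<close>
  assume "n \<ge> nat \<lceil>2 * \<bar>w\<bar> + \<bar>m\<bar>\<rceil>"
  then have n: "real n \<ge> 2 * \<bar>w\<bar> + \<bar>m\<bar>" by linarith
  define q where "q = rGamma (real n + m + 2) / fact n * w ^ n"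
  have "real n + m + 1 \<ge> 1" using n by linarith
  then have "\<bar>w\<bar> * 1 \<le> 1 / 2 * (real n + 1) * (real n + m + 1)"
    using n by (intro mult_mono) auto
  then have "\<bar>w\<bar> / (real n + 1) * \<bar>q\<bar> \<le> 1 / 2 * (real n + m + 1) * \<bar>q\<bar>"
    by (intro mult_right_mono) (auto simp: field_simps)
  moreover have "rGamma (real (Suc n) + m + 1) / fact (Suc n) * w ^ Suc n = w / (real n + 1) * q"
    by (simp add: q_def field_simps add_ac)
  moreover have "rGamma (real n + m + 1) / fact n * w ^ n = (real n + m + 1) * q"
    using rGamma_plus1[of "real n + m + 1"] by (simp add: q_def field_simps add_ac)
  ultimately show "norm (rGamma (real (Suc n) + m + 1) / fact (Suc n) * w ^ Suc n)
      \<le> 1 / 2 * norm (rGamma (real n + m + 1) / fact n * w ^ n)"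
    using \<open>real n + m + 1 \<ge> 1\<close> by (simp add: abs_mult)
qed

lemma bessel_phi_deriv:
  "(bessel_phi m has_real_derivative bessel_phi (m + 1) w) (at w)"
proof -
  have "diffs (\<lambda>k. rGamma (real k + m + 1) / fact k) = (\<lambda>k. rGamma (real k + (m + 1) + 1) / fact k)"
    by (simp add: diffs_def fun_eq_iff add_ac)
  moreover have "((\<lambda>w. \<Sum>k. rGamma (real k + m + 1) / fact k * w ^ k) has_real_derivative
      (\<Sum>k. diffs (\<lambda>k. rGamma (real k + m + 1) / fact k) k * w ^ k)) (at w)"
    by (intro termdiffs_strong_converges_everywhere summable_bessel_phi)
  ultimately show ?thesis
    by (simp add: bessel_phi_def [abs_def])
qed

text \<open>Termwise, k + m + 2 = (m + 1) + (k + 1), and the summand k + 1 cancels against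
  \<open>fact (Suc k)\<close>, which shifts the last series by one. Together with
  \<open>bessel_phi_deriv\<close> this is the differential equation w f'' + (m + 1) f' = f for f =
  \<open>bessel_phi m\<close>.\<close>

lemma bessel_phi_rec:
  "bessel_phi m w = (m + 1) * bessel_phi (m + 1) w + w * bessel_phi (m + 2) w"
proof -
  let ?a = "\<lambda>m k. rGamma (real k + m + 1) / fact k * w ^ k"
  have split: "?a m (Suc k) = (m + 1) * ?a (m + 1) (Suc k) + w * ?a (m + 2) k" for k
  proof -
    define q where "q = rGamma (real k + m + 3)"
    have "rGamma (real (Suc k) + m + 1) = (real k + m + 2) * q"
      using rGamma_plus1[of "real k + m + 2"] by (simp add: q_def add_ac)
    moreover have "rGamma (real (Suc k) + (m + 1) + 1) = q" "rGamma (real k + (m + 2) + 1) = q"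
      by (simp_all add: q_def add_ac)
    ultimately have eqs: "?a m (Suc k) = (real k + m + 2) * q / ((real k + 1) * fact k) * (w * w ^ k)"
      "?a (m + 1) (Suc k) = q / ((real k + 1) * fact k) * (w * w ^ k)"
      "?a (m + 2) k = q / fact k * w ^ k"
      by (simp_all only: fact_Suc power_Suc) (simp_all add: add_ac)
    show ?thesis
      unfolding eqs by (simp add: divide_simps) (simp add: algebra_simps)
  qed
  have s: "summable (?a (m + 1))" "summable (?a (m + 2))" "summable (?a m)"
    by (rule summable_bessel_phi)+
  have s': "summable (\<lambda>k. ?a (m + 1) (Suc k))"
    by (rule summable_Suc_iff[THEN iffD2, OF s(1)])
  have "bessel_phi m w = ?a m 0 + (\<Sum>k. ?a m (Suc k))"
    unfolding bessel_phi_def by (subst suminf_split_head[OF s(3)]) simp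
  also have "(\<Sum>k. ?a m (Suc k)) = (\<Sum>k. (m + 1) * ?a (m + 1) (Suc k)) + (\<Sum>k. w * ?a (m + 2) k)"
    unfolding split by (intro suminf_add [symmetric] summable_mult s s')
  also have "(\<Sum>k. (m + 1) * ?a (m + 1) (Suc k)) = (m + 1) * (\<Sum>k. ?a (m + 1) (Suc k))"
    by (rule suminf_mult[OF s'])
  also have "(\<Sum>k. ?a (m + 1) (Suc k)) = bessel_phi (m + 1) w - ?a (m + 1) 0"
    unfolding bessel_phi_def by (rule suminf_split_head[OF s(1)])
  also have "(\<Sum>k. w * ?a (m + 2) k) = w * bessel_phi (m + 2) w"
    unfolding bessel_phi_def by (rule suminf_mult[OF s(2)])
  \<comment> \<open>The two constant terms agree because rGamma(m + 1) = (m + 1) rGamma(m +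
    2).\<close>
  finally show ?thesis
    using rGamma_plus1[of "m + 1"] by (simp add: algebra_simps)
qed

lemma bessel_phi_pos:
  assumes "m > -1" "w \<ge> 0"
  shows "bessel_phi m w > 0"
proof -
  have pos: "rGamma (real k + m + 1) > 0" for k
    using assms by (simp add: rGamma_inverse_Gamma)
  then have "(\<Sum>k\<in>{0}. rGamma (real k + m + 1) / fact k * w ^ k) > 0"
    and "\<And>k. rGamma (real k + m + 1) / fact k * w ^ k \<ge> 0"
    using assms pos[of 0] by (auto simp: less_imp_le)
  moreover have "(\<Sum>k\<in>{0}. rGamma (real k + m + 1) / fact k * w ^ k) \<le> bessel_phi m w"
    unfolding bessel_phi_def by (rule sum_le_suminf[OF summable_bessel_phi]) (use calculation in auto)
  ultimately show ?thesis by linarith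
qed

lemma bessel_I_eq:
  assumes "x > 0"
  shows "bessel_I m x = (x / 2) powr m * bessel_phi m ((x / 2)\<^sup>2)"
proof -
  have term_eq: "1 / (fact k * Gamma (real k + m + 1)) * (x / 2) powr (2 * real k + m)
      = (x / 2) powr m * (rGamma (real k + m + 1) / fact k * ((x / 2)\<^sup>2) ^ k)" for k
  proof -
    have "(x / 2) powr (2 * real k + m) = (x / 2) powr m * (x / 2) powr real (2 * k)"
      using powr_add[of "x / 2" m "2 * real k"] by (simp add: add_ac)
    also have "(x / 2) powr real (2 * k) = ((x / 2)\<^sup>2) ^ k"
      using assms by (subst powr_realpow) (auto simp: power_mult)
    finally have "(x / 2) powr (2 * real k + m) = (x / 2) powr m * ((x / 2)\<^sup>2) ^ k" .
    moreover have "1 / (fact k * Gamma (real k + m + 1)) = rGamma (real k + m + 1) / fact k"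
      by (simp add: rGamma_inverse_Gamma divide_inverse)
    ultimately show ?thesis by (simp only: mult_ac)
  qed
  show ?thesis
    unfolding bessel_I_def bessel_phi_def term_eq by (rule suminf_mult[OF summable_bessel_phi])
qed

section \<open>The logarithmic derivative and its Riccati equation\<close>

text \<open>In terms of x = 2 sqrt w this is (x / 2) I_{m+1}(x) / I_m(x).\<close>

definition bessel_ratio :: "real \<Rightarrow> real \<Rightarrow> real" where
  "bessel_ratio m w = w * bessel_phi (m + 1) w / bessel_phi m w"

lemma bessel_ratio_0 [simp]: "bessel_ratio m 0 = 0"
  by (simp add: bessel_ratio_def)

lemma bessel_ratio_nonneg:
  assumes "m > -1" "w \<ge> 0"
  shows "bessel_ratio m w \<ge> 0"
  using assms bessel_phi_pos[of m w] bessel_phi_pos[of "m + 1" w]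
  by (auto simp: bessel_ratio_def)

text \<open>Dropping the positive or zero last term of the recurrence bounds the ratio linearly;
  this controls the curvature near the origin.\<close>

lemma bessel_ratio_le:
  assumes "m > -1" "w \<ge> 0"
  shows "bessel_ratio m w \<le> w / (m + 1)"
proof -
  have "(m + 1) * bessel_phi (m + 1) w \<le> bessel_phi m w"
    using bessel_phi_rec[of m w] bessel_phi_pos[of "m + 2" w] assms by simp
  then have "w * ((m + 1) * bessel_phi (m + 1) w) \<le> w * bessel_phi m w"
    using assms by (intro mult_left_mono) auto
  then show ?thesis
    using bessel_phi_pos[of m w] assms by (simp add: bessel_ratio_def field_simps)
qed

lemma continuous_on_bessel_ratio:
  assumes "m > -1"
  shows "continuous_on {0..} (bessel_ratio m)"
proof -
  have "continuous_on {0..} (bessel_phi n)" for n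
    by (meson DERIV_continuous bessel_phi_deriv continuous_at_imp_continuous_on)
  then show ?thesis
    unfolding bessel_ratio_def [abs_def]
    using bessel_phi_pos[OF assms]
    by (intro continuous_intros) (auto simp: less_imp_neq[THEN not_sym])
qed

text \<open>The quotient rule produces \<open>bessel_phi (m + 2) w\<close>, which the recurrence
  eliminates.\<close>

lemma bessel_ratio_deriv:
  assumes "m > -1" "w > 0"
  shows "(bessel_ratio m has_real_derivative
    (w - (bessel_ratio m w)\<^sup>2 - m * bessel_ratio m w) / w) (at w)"
proof -
  have pos: "bessel_phi m w > 0" using assms by (simp add: bessel_phi_pos)
  have rec: "w * bessel_phi (m + 2) w = bessel_phi m w - (m + 1) * bessel_phi (m + 1) w"
    using bessel_phi_rec[of m w] by simp
  have "(bessel_ratio m has_real_derivative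
      ((bessel_phi (m + 1) w + w * bessel_phi (m + 2) w) * bessel_phi m w
        - w * bessel_phi (m + 1) w * bessel_phi (m + 1) w) / (bessel_phi m w * bessel_phi m w)) (at w)"
    unfolding bessel_ratio_def [abs_def] using pos
    by (auto intro!: derivative_eq_intros bessel_phi_deriv
          DERIV_cong[OF bessel_phi_deriv[of "m + 1"]] simp: add_ac algebra_simps)
  also have "((bessel_phi (m + 1) w + w * bessel_phi (m + 2) w) * bessel_phi m w
        - w * bessel_phi (m + 1) w * bessel_phi (m + 1) w) / (bessel_phi m w * bessel_phi m w)
      = (w - (bessel_ratio m w)\<^sup>2 - m * bessel_ratio m w) / w"
    unfolding rec bessel_ratio_def using pos assms(2)
    by (simp add: field_simps power2_eq_square)
  finally show ?thesis .
qed

section \<open>The curvature of the log-density and its differential equation\<close>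

text \<open>The second derivative of the log-density at \<open>x\<close> is \<open>2 / x\<^sup>2\<close> times this at \<open>w = (x / (2 b))\<^sup>2\<close>.\<close>

definition curvature :: "real \<Rightarrow> real \<Rightarrow> real" where
  "curvature m w = 2 * w - (2 * bessel_ratio m w + 1) * (bessel_ratio m w + m)"

lemma continuous_on_curvature:
  assumes "m > -1"
  shows "continuous_on {0..} (curvature m)"
  unfolding curvature_def [abs_def]
  by (intro continuous_intros continuous_on_bessel_ratio assms)

text \<open>With r the ratio and F the curvature, the Riccati equation reads 2 w r' = F + r + m.
  Inserting this and 2 w = F + (2 r + 1)(r + m) into w F' = 2 w - w r' (4 r + 2 m + 1) leaves an
  expression linear in F.\<close>

lemma curvature_deriv:
  assumes "m > -1" "w > 0"
  shows "(curvature m has_real_derivative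
    (curvature m w * (1 / 2 - 2 * bessel_ratio m w - m)
      + (bessel_ratio m w + m) * (1 / 2 - m)) / w) (at w)"
proof -
  define r where "r = bessel_ratio m w"
  define d where "d = (w - r\<^sup>2 - m * r) / w"
  have d: "(bessel_ratio m has_real_derivative d) (at w)"
    unfolding d_def r_def by (rule bessel_ratio_deriv[OF assms])
  have "(curvature m has_real_derivative 2 - d * (4 * r + 2 * m + 1)) (at w)"
    unfolding curvature_def [abs_def]
    by (auto intro!: derivative_eq_intros d simp: r_def algebra_simps)
  also have "2 - d * (4 * r + 2 * m + 1)
      = (curvature m w * (1 / 2 - 2 * r - m) + (r + m) * (1 / 2 - m)) / w"
    using assms(2) unfolding d_def curvature_def r_def [symmetric]
    by (simp add: field_simps power2_eq_square)
  finally show ?thesis unfolding r_def .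
qed

definition weighted_curvature :: "real \<Rightarrow> real \<Rightarrow> real" where
  "weighted_curvature m w = curvature m w * (w powr (m - 1 / 2) * (bessel_phi m w)\<^sup>2)"

text \<open>The weight has logarithmic derivative (m - 1/2 + 2 r) / w, which cancels the coefficient
  of the curvature in \<open>curvature_deriv\<close>; only the forcing term (r + m)(1/2 - m)
  survives.\<close>

lemma weighted_curvature_deriv:
  assumes "m > -1" "w > 0"
  shows "(weighted_curvature m has_real_derivative
    (bessel_ratio m w + m) * (1 / 2 - m) * (w powr (m - 1 / 2) * (bessel_phi m w)\<^sup>2) / w) (at w)"
proof -
  define P where "P = w powr (m - 1 / 2)"
  define r where "r = bessel_ratio m w"
  define p where "p = bessel_phi m w"
  define k where "k = curvature m w"
  have p: "p > 0" unfolding p_def using assms by (simp add: bessel_phi_pos)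
  have q: "bessel_phi (m + 1) w = r * p / w"
    using assms(2) p by (simp add: r_def p_def bessel_ratio_def)
  have dP: "((\<lambda>w. w powr (m - 1 / 2)) has_real_derivative (m - 1 / 2) * P / w) (at w)"
    using has_real_derivative_powr[OF assms(2), of "m - 1 / 2"] powr_diff[of w "m - 1 / 2" 1] assms(2)
    by (simp add: P_def)
  have dp: "((\<lambda>w. (bessel_phi m w)\<^sup>2) has_real_derivative 2 * p * (r * p / w)) (at w)"
    using DERIV_power[OF bessel_phi_deriv[of m w], where n = 2] by (simp add: q p_def mult_ac)
  have dk: "(curvature m has_real_derivative (k * (1 / 2 - 2 * r - m) + (r + m) * (1 / 2 - m)) / w) (at w)"
    unfolding k_def r_def by (rule curvature_deriv[OF assms])
  have "(weighted_curvature m has_real_derivative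
      (k * (1 / 2 - 2 * r - m) + (r + m) * (1 / 2 - m)) / w * (P * p\<^sup>2)
      + k * ((m - 1 / 2) * P / w * p\<^sup>2 + P * (2 * p * (r * p / w)))) (at w)"
    unfolding weighted_curvature_def [abs_def]
    using DERIV_mult[OF dk DERIV_mult[OF dP dp]]
    by (simp add: P_def [symmetric] p_def [symmetric] k_def [symmetric] algebra_simps)
  also have "(k * (1 / 2 - 2 * r - m) + (r + m) * (1 / 2 - m)) / w * (P * p\<^sup>2)
      + k * ((m - 1 / 2) * P / w * p\<^sup>2 + P * (2 * p * (r * p / w)))
      = (r + m) * (1 / 2 - m) * (P * p\<^sup>2) / w"
    using assms(2) by (simp add: field_simps power2_eq_square)
  finally show ?thesis unfolding P_def r_def p_def .
qed

lemma weighted_curvature_sgn: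
  assumes "m > -1" "w > 0"
  shows "weighted_curvature m w < 0 \<longleftrightarrow> curvature m w < 0"
    and "weighted_curvature m w \<ge> 0 \<longleftrightarrow> curvature m w \<ge> 0"
proof -
  have "w powr (m - 1 / 2) * (bessel_phi m w)\<^sup>2 > 0"
    using assms bessel_phi_pos[of m w] by simp
  then show "weighted_curvature m w < 0 \<longleftrightarrow> curvature m w < 0"
    and "weighted_curvature m w \<ge> 0 \<longleftrightarrow> curvature m w \<ge> 0"
    unfolding weighted_curvature_def by (auto simp: mult_less_0_iff zero_le_mult_iff)
qed

section \<open>Sign of the curvature in the different ranges of m\<close>

lemma curvature_neg_near_0:
  assumes "m > 0" "w > 0"
  obtains v where "0 < v" "v < w" "curvature m v < 0"
proof -
  have "continuous_on {0..w} (curvature m)"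
    using continuous_on_curvature[of m] assms by (auto intro: continuous_on_subset)
  then have "(curvature m \<longlongrightarrow> curvature m 0) (at_right 0)"
    using assms(2) by (simp add: continuous_on_Icc_at_rightD)
  moreover have "curvature m 0 < 0"
    using assms by (simp add: curvature_def)
  ultimately have "eventually (\<lambda>v. curvature m v < 0) (at_right 0)"
    by (rule order_tendstoD)
  moreover have "eventually (\<lambda>v. v \<in> {0<..<w}) (at_right 0)"
    by (rule eventually_at_right_real[OF assms(2)])
  ultimately have "eventually (\<lambda>v. curvature m v < 0 \<and> v \<in> {0<..<w}) (at_right 0)"
    by (rule eventually_conj)
  then show ?thesis
    using that eventually_happens[of _ "at_right (0::real)"] by auto
qed

lemma curvature_neg:
  assumes "m \<ge> 1 / 2" "w > 0"
  shows "curvature m w < 0"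
proof -
  \<comment> \<open>The comparison starts at a positive \<open>v\<close>: the derivative formula
    holds only for positive arguments, and at 0 the weight is 0 since \<open>0 powr a = 0\<close>,
    so the sign of the curvature would be lost there.\<close>
  obtain v where v: "0 < v" "v < w" "curvature m v < 0"
    using curvature_neg_near_0[of m w] assms by auto
  have "weighted_curvature m w \<le> weighted_curvature m v"
  proof (rule DERIV_nonpos_imp_nonincreasing[of v w "weighted_curvature m"])
    fix x assume "v \<le> x" "x \<le> w"
    with v have x: "x > 0" by simp
    have "(bessel_ratio m x + m) * (1 / 2 - m) \<le> 0"
      using assms bessel_ratio_nonneg[of m x] x by (intro mult_nonneg_nonpos) auto
    then show "\<exists>d. (weighted_curvature m has_real_derivative d) (at x) \<and> d \<le> 0"
      using weighted_curvature_deriv[of m x] assms x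
      by (intro exI[of _ "(bessel_ratio m x + m) * (1 / 2 - m)
          * (x powr (m - 1 / 2) * (bessel_phi m x)\<^sup>2) / x"] conjI)
        (auto intro!: divide_nonpos_pos mult_nonpos_nonneg)
  qed (use v in auto)
  moreover have "weighted_curvature m v < 0"
    using weighted_curvature_sgn(1)[of m v] v assms by simp
  ultimately show ?thesis
    using weighted_curvature_sgn(1)[of m w] assms by simp
qed

lemma curvature_pos_if:
  assumes "m > -1" "w > 0" "bessel_ratio m w + m \<le> 0"
  shows "curvature m w > 0"
proof -
  have "(2 * bessel_ratio m w + 1) * (bessel_ratio m w + m) \<le> 0"
    using assms bessel_ratio_nonneg[of m w] by (intro mult_nonneg_nonpos) auto
  then show ?thesis using assms(2) by (simp add: curvature_def)
qed

text \<open>At \<open>m = 0\<close> the curvature vanishes at the origin, so continuity alone does not give the sign near it.\<close>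

lemma curvature_nonneg_small:
  assumes "- 1 / 2 < m" "m \<le> 0" "0 < w" "w \<le> 1 / 4"
  shows "curvature m w \<ge> 0"
proof (cases "bessel_ratio m w + m \<le> 0")
  case True
  then show ?thesis using curvature_pos_if[of m w] assms by simp
next
  case False
  let ?r = "bessel_ratio m w"
  have le: "?r \<le> w / (m + 1)" and r0: "?r \<ge> 0"
    using bessel_ratio_le[of m w] bessel_ratio_nonneg[of m w] assms by auto
  \<comment> \<open>Here m + 1 > 1/2 meets the threshold w \<le> 1/4.\<close>
  have "w / (m + 1) \<le> 1 / 2"
    using assms by (simp add: field_simps)
  then have r1: "2 * ?r + 1 \<le> 2" using le by linarith
  \<comment> \<open>Divided by m + 1, this is the next inequality; the two factors of the product
    are thus bounded by 2 and by w.\<close>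
  have "m * (m + 1 - w) \<le> 0"
    using assms by (intro mult_nonpos_nonneg) auto
  then have "w / (m + 1) + m \<le> w"
    using assms by (simp add: field_simps)
  then have "?r + m \<le> w" using le by linarith
  then have "(2 * ?r + 1) * (?r + m) \<le> 2 * w"
    using r1 r0 False by (intro mult_mono) auto
  then show ?thesis by (simp add: curvature_def)
qed

text \<open>After the last point \<open>s\<close> before \<open>w\<close> with nonnegative
  curvature, the curvature is negative, hence r + m is positive by \<open>curvature_pos_if\<close>.
  The weighted curvature therefore cannot decrease from its nonnegative value at \<open>s\<close>,
  yet it would be negative at \<open>w\<close>.\<close>

lemma curvature_nonneg:
  assumes m: "- 1 / 2 < m" "m \<le> 0" and w: "w > 0"
  shows "curvature m w \<ge> 0"
proof (rule ccontr)
  assume neg: "\<not> curvature m w \<ge> 0"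
  then have w4: "1 / 4 < w"
    using curvature_nonneg_small[OF m w] by linarith
  \<comment> \<open>The left end 1/4 lies in the range of \<open>curvature_nonneg_small\<close>, so
    \<open>Z\<close> is nonempty; compactness then provides its maximum.\<close>
  define Z where "Z = {t \<in> {1/4..w}. 0 \<le> curvature m t}"
  have "continuous_on {1/4..w} (curvature m)"
    using continuous_on_curvature[of m] m by (auto intro: continuous_on_subset)
  then have "closed Z"
    unfolding Z_def by (intro continuous_on_closed_Collect_le continuous_intros) auto
  then have "compact Z"
    unfolding compact_eq_bounded_closed
    by (auto intro: bounded_subset[OF bounded_closed_interval[of "1 / 4" w]] simp: Z_def)
  moreover have "1 / 4 \<in> Z"
    using curvature_nonneg_small[OF m, of "1 / 4"] w4 by (auto simp: Z_def)
  ultimately obtain s where s: "s \<in> Z" and s_max: "\<And>t. t \<in> Z \<Longrightarrow> t \<le> s"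
    using compact_attains_sup[of Z] by blast
  have "s < w" "s \<ge> 1 / 4" "curvature m s \<ge> 0"
    using s neg by (auto simp: Z_def less_le)
  have "weighted_curvature m s \<le> weighted_curvature m w"
  proof (rule DERIV_nonneg_imp_increasing_open[of s w "weighted_curvature m"])
    fix x assume x: "s < x" "x < w"
    then have "x > 0" using \<open>s \<ge> 1 / 4\<close> by simp
    have "curvature m x < 0"
      using s_max[of x] x \<open>s \<ge> 1 / 4\<close> by (force simp: Z_def)
    then have "bessel_ratio m x + m \<ge> 0"
      using curvature_pos_if[of m x] m \<open>x > 0\<close> by force
    then show "\<exists>d. (weighted_curvature m has_real_derivative d) (at x) \<and> d \<ge> 0"
      using weighted_curvature_deriv[of m x] m \<open>x > 0\<close>
      by (intro exI[of _ "(bessel_ratio m x + m) * (1 / 2 - m)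
          * (x powr (m - 1 / 2) * (bessel_phi m x)\<^sup>2) / x"] conjI) auto
  next
    have "isCont (weighted_curvature m) x" if "x \<in> {s..w}" for x
      using weighted_curvature_deriv[of m x] that m \<open>s \<ge> 1 / 4\<close> by (auto intro: DERIV_isCont)
    then show "continuous_on {s..w} (weighted_curvature m)"
      by (simp add: continuous_at_imp_continuous_on)
  qed (use \<open>s < w\<close> in auto)
  moreover have "weighted_curvature m s \<ge> 0"
    using weighted_curvature_sgn(2)[of m s] m \<open>s \<ge> 1 / 4\<close> \<open>curvature m s \<ge> 0\<close> by simp
  ultimately show False
    using weighted_curvature_sgn(2)[of m w] m w neg by simp
qed

lemma curvature_pos_somewhere:
  assumes m: "- 1 / 2 < m" "m < 1 / 2"
  obtains w where "w > 0" "curvature m w > 0"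
proof (rule ccontr)
  assume "\<not> thesis"
  then have neg: "curvature m w \<le> 0" if "w > 0" for w
    using that by (meson \<open>\<And>w. \<lbrakk>0 < w; 0 < curvature m w\<rbrakk> \<Longrightarrow> thesis\<close> not_le)
  \<comment> \<open>For r \<ge> R the forcing term (r + m)(1/2 - m) is at least 1, because m > -1,
    and R > 1 makes the coefficient 1/2 - 2 r - m negative.\<close>
  define R where "R = 1 + 1 / (1 / 2 - m)"
  \<comment> \<open>If r < R, then (2 r + 1)(r + m) \<le> W, so nonpositive curvature would force 2
    w \<le> W. Hence r \<ge> R for all w \<ge> W.\<close>
  define W where "W = (2 * R + 1) * (R + 1)"
  have "R > 1" using m by (simp add: R_def)
  then have "W > 1" unfolding W_def by (intro less_1_mult) auto
  have large: "bessel_ratio m w \<ge> R" if "w \<ge> W" for w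
  proof (rule ccontr)
    let ?r = "bessel_ratio m w"
    assume "\<not> ?r \<ge> R"
    moreover have "?r \<ge> 0" using bessel_ratio_nonneg[of m w] m that \<open>W > 1\<close> by simp
    ultimately have "(2 * ?r + 1) * (?r + m) \<le> (2 * ?r + 1) * (R + 1)"
      and "(2 * ?r + 1) * (R + 1) \<le> (2 * R + 1) * (R + 1)"
      using m \<open>R > 1\<close> by (auto intro!: mult_left_mono mult_right_mono)
    then show False
      using neg[of w] that \<open>W > 1\<close> by (simp add: W_def curvature_def)
  qed
  \<comment> \<open>chosen so that the lower bound \<open>curvature m W + ln (v / W)\<close> on the curvature at \<open>v\<close> equals 1\<close>
  define v where "v = W * exp (1 - curvature m W)"
  have "v > W" using neg[of W] \<open>W > 1\<close> by (simp add: v_def)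
  have "curvature m W - ln W \<le> curvature m v - ln v"
  proof (rule DERIV_nonneg_imp_nondecreasing[of W v "\<lambda>x. curvature m x - ln x"])
    fix x assume "W \<le> x" "x \<le> v"
    then have "x > 0" using \<open>W > 1\<close> by simp
    let ?r = "bessel_ratio m x"
    let ?n = "curvature m x * (1 / 2 - 2 * ?r - m) + (?r + m) * (1 / 2 - m)"
    have "?r \<ge> R" by (rule large) fact
    \<comment> \<open>Both factors are nonpositive, so the numerator of the derivative keeps at
      least the forcing term.\<close>
    then have "curvature m x * (1 / 2 - 2 * ?r - m) \<ge> 0"
      using neg[OF \<open>x > 0\<close>] \<open>R > 1\<close> m by (intro mult_nonpos_nonpos) auto
    moreover have "(1 / (1 / 2 - m)) * (1 / 2 - m) \<le> (?r + m) * (1 / 2 - m)"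
      using \<open>?r \<ge> R\<close> m by (intro mult_right_mono) (auto simp: R_def)
    ultimately have "?n \<ge> 1" using m by simp
    moreover have "((\<lambda>x. curvature m x - ln x) has_real_derivative ?n / x - 1 / x) (at x)"
      using m \<open>x > 0\<close> by (auto intro!: derivative_eq_intros curvature_deriv)
    ultimately show "\<exists>d. ((\<lambda>x. curvature m x - ln x) has_real_derivative d) (at x) \<and> d \<ge> 0"
      using \<open>x > 0\<close> by (intro exI conjI) (auto simp: diff_divide_distrib [symmetric])
  qed (use \<open>v > W\<close> in auto)
  moreover have "ln v = ln W + (1 - curvature m W)"
    using \<open>W > 1\<close> by (simp add: v_def ln_mult)
  ultimately show False
    using neg[of v] \<open>v > W\<close> \<open>W > 1\<close> by simp
qed

section \<open>Second-derivative criteria for convexity and log-convexity\<close>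

text \<open>A convex function lies above its tangents. Adding the tangent inequalities at two points
  shows that \<open>f'\<close> is monotone, so its derivative is nonnegative.\<close>

lemma convex_on_second_deriv_nonneg:
  fixes f :: "real \<Rightarrow> real"
  assumes convex: "convex_on A f" and "open A"
    and f': "\<And>x. x \<in> A \<Longrightarrow> (f has_real_derivative f' x) (at x)"
    and f'': "(f' has_real_derivative D) (at x)" and "x \<in> A"
  shows "D \<ge> 0"
proof (rule mono_on_imp_deriv_nonneg)
  have "connected A"
    using convex by (auto simp: convex_on_def convex_connected)
  then have tangent: "f z - f y \<ge> f' y * (z - y)" if "y \<in> A" "z \<in> A" for y z
    using that \<open>open A\<close> convex f'[THEN has_field_derivative_at_within]
    by (intro convex_on_imp_above_tangent[of A]) (auto simp: interior_open)
  show "mono_on A f'"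
  proof (rule mono_onI)
    fix y z assume yz: "y \<in> A" "z \<in> A" "y \<le> z"
    have "(f' z - f' y) * (z - y) \<ge> 0"
      using tangent[OF yz(1,2)] tangent[OF yz(2,1)] by (simp add: algebra_simps)
    then show "f' y \<le> f' z"
      using yz(3) by (cases "y = z") (auto simp: zero_le_mult_iff)
  qed
  show "x \<in> interior A" using assms by (simp add: interior_open)
qed (rule f'')

lemma convex_on_iff_second_deriv_nonneg:
  fixes f :: "real \<Rightarrow> real"
  assumes "convex A" "open A"
    and "\<And>x. x \<in> A \<Longrightarrow> (f has_real_derivative f' x) (at x)"
    and "\<And>x. x \<in> A \<Longrightarrow> (f' has_real_derivative f'' x) (at x)"
  shows "convex_on A f \<longleftrightarrow> (\<forall>x\<in>A. f'' x \<ge> 0)"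
  using convex_on_second_deriv_nonneg[of A f f'] f''_ge0_imp_convex[of A f f' f''] assms by blast

lemma concave_on_iff_second_deriv_nonpos:
  fixes f :: "real \<Rightarrow> real"
  assumes "convex A" "open A"
    and "\<And>x. x \<in> A \<Longrightarrow> (f has_real_derivative f' x) (at x)"
    and "\<And>x. x \<in> A \<Longrightarrow> (f' has_real_derivative f'' x) (at x)"
  shows "concave_on A f \<longleftrightarrow> (\<forall>x\<in>A. f'' x \<le> 0)"
  unfolding concave_on_def
  using convex_on_iff_second_deriv_nonneg[of A "\<lambda>x. - f x" "\<lambda>x. - f' x" "\<lambda>x. - f'' x"] assms
  by (auto intro: DERIV_minus)

text \<open>The weight \<open>t\<close> sits on \<open>x\<close>, as in
  \<open>log_convex_on\<close>, whereas the library puts 1 - t there; replacing t by 1 - t passes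
  between the two.\<close>

lemma convex_on_real_iff:
  fixes f :: "real \<Rightarrow> real"
  assumes "convex J"
  shows "convex_on J f \<longleftrightarrow>
    (\<forall>x\<in>J. \<forall>y\<in>J. \<forall>t\<in>{0..1}. f (t * x + (1 - t) * y) \<le> t * f x + (1 - t) * f y)"
proof
  assume f: "convex_on J f"
  show "\<forall>x\<in>J. \<forall>y\<in>J. \<forall>t\<in>{0..1}. f (t * x + (1 - t) * y) \<le> t * f x + (1 - t) * f y"
    using convex_onD[OF f, of "1 - t" for t] by auto
next
  assume *: "\<forall>x\<in>J. \<forall>y\<in>J. \<forall>t\<in>{0..1}. f (t * x + (1 - t) * y) \<le> t * f x + (1 - t) * f y"
  show "convex_on J f"
  proof (rule convex_onI[OF _ assms])
    fix t x y :: real assume "0 < t" "t < 1" "x \<in> J" "y \<in> J"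
    then show "f ((1 - t) *\<^sub>R x + t *\<^sub>R y) \<le> (1 - t) * f x + t * f y"
      using *[rule_format, of x y "1 - t"] by simp
  qed
qed

lemma ln_powr_mult_powr:
  fixes a b :: real
  assumes "a > 0" "b > 0"
  shows "ln (a powr s * b powr t) = s * ln a + t * ln b"
  using assms by (simp add: ln_mult ln_powr)

text \<open>Since ln is strictly increasing on positive reals, the multiplicative inequality can be
  compared through logarithms; convexity of \<open>J\<close> gives positivity of \<open>h\<close> at
  the intermediate point.\<close>

lemma log_convex_on_iff:
  assumes J: "is_interval J" and pos: "\<And>x. x \<in> J \<Longrightarrow> 0 < h x"
  shows "log_convex_on J h \<longleftrightarrow> convex_on J (\<lambda>x. ln (h x))"
proof -
  have conv: "convex J" using J by (simp add: is_interval_convex)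
  have "h (t * x + (1 - t) * y) \<le> h x powr t * h y powr (1 - t) \<longleftrightarrow>
      ln (h (t * x + (1 - t) * y)) \<le> t * ln (h x) + (1 - t) * ln (h y)"
    if "x \<in> J" "y \<in> J" "t \<in> {0..1}" for x y t
  proof -
    have "t * x + (1 - t) * y \<in> J"
      using convexD[OF conv that(1,2), of t "1 - t"] that(3) by simp
    then have "h (t * x + (1 - t) * y) > 0" "h x > 0" "h y > 0"
      using pos that by auto
    then show ?thesis
      by (subst ln_powr_mult_powr[symmetric]) auto
  qed
  then show ?thesis
    unfolding log_convex_on_def convex_on_real_iff[OF conv] using J pos by simp
qed

lemma log_concave_on_iff:
  assumes J: "is_interval J" and pos: "\<And>x. x \<in> J \<Longrightarrow> 0 < h x"
  shows "log_concave_on J h \<longleftrightarrow> concave_on J (\<lambda>x. ln (h x))"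
proof -
  have conv: "convex J" using J by (simp add: is_interval_convex)
  have "h (t * x + (1 - t) * y) \<ge> h x powr t * h y powr (1 - t) \<longleftrightarrow>
      - ln (h (t * x + (1 - t) * y)) \<le> t * - ln (h x) + (1 - t) * - ln (h y)"
    if "x \<in> J" "y \<in> J" "t \<in> {0..1}" for x y t
  proof -
    have "t * x + (1 - t) * y \<in> J"
      using convexD[OF conv that(1,2), of t "1 - t"] that(3) by simp
    then have "h (t * x + (1 - t) * y) > 0" "h x > 0" "h y > 0"
      using pos that by auto
    then have "h (t * x + (1 - t) * y) \<ge> h x powr t * h y powr (1 - t) \<longleftrightarrow>
        t * ln (h x) + (1 - t) * ln (h y) \<le> ln (h (t * x + (1 - t) * y))"
      by (subst ln_powr_mult_powr[symmetric]) auto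
    then show ?thesis by auto
  qed
  then show ?thesis
    unfolding log_concave_on_def concave_on_def convex_on_real_iff[OF conv] using J pos by simp
qed

section \<open>The log-density and its derivatives\<close>

context
  fixes b c m :: real
  assumes b: "b > 0" and c: "c > 1" and m: "m > - 1 / 2"
begin

text \<open>The last divisor comes from the factor (x / (2 b))^m of the Bessel function, whose x^m
  joins that of the density to give x^(2 m).\<close>

definition mcKay_I_const :: real where
  "mcKay_I_const = sqrt pi * (c\<^sup>2 - 1) powr (m + 1 / 2)
    / (2 powr m * b powr (m + 1) * Gamma (m + 1 / 2)) / (2 * b) powr m"

lemma mcKay_I_const_pos: "mcKay_I_const > 0"
proof -
  have "c\<^sup>2 > 1" using c by (simp add: one_less_power)
  then show ?thesis using b m by (simp add: mcKay_I_const_def)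
qed

lemma mcKay_I_density_eq:
  assumes "x > 0"
  shows "mcKay_I_density b c m x
    = mcKay_I_const * x powr (2 * m) * exp (- (c * x / b)) * bessel_phi m ((x / (2 * b))\<^sup>2)"
proof -
  have "(x / b / 2) powr m = x powr m / (2 * b) powr m"
    using assms b by (simp add: powr_divide powr_mult)
  then show ?thesis
    using assms b powr_add[of x m m]
    by (simp add: mcKay_I_density_def mcKay_I_const_def bessel_I_eq mult_ac)
qed

lemma mcKay_I_density_pos:
  assumes "x > 0"
  shows "mcKay_I_density b c m x > 0"
proof -
  have "bessel_phi m ((x / (2 * b))\<^sup>2) > 0"
    using m by (intro bessel_phi_pos) auto
  then show ?thesis
    unfolding mcKay_I_density_eq[OF assms] using assms mcKay_I_const_pos by simp
qed

text \<open>The logarithm is a constant plus 2 m ln x - c x / b + ln Phi_m(w) with w = (x / (2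
  b))^2. The term with \<open>c\<close> is linear and drops out of the second derivative, and
  \<open>b\<close> enters only through w. By the chain rule, x d/dx = 2 w d/dw.\<close>

lemma ln_mcKay_I_density_derivs:
  defines "g \<equiv> \<lambda>x. (2 * m + 2 * bessel_ratio m ((x / (2 * b))\<^sup>2)) / x - c / b"
  assumes x: "x > 0"
  shows "((\<lambda>x. ln (mcKay_I_density b c m x)) has_real_derivative g x) (at x)"
    and "(g has_real_derivative 2 * curvature m ((x / (2 * b))\<^sup>2) / x\<^sup>2) (at x)"
proof -
  define w where "w = (x / (2 * b))\<^sup>2"
  have w: "w > 0" using x b by (simp add: w_def)
  have pos: "bessel_phi m w > 0" using w m by (simp add: bessel_phi_pos)
  have dw: "((\<lambda>x. (x / (2 * b))\<^sup>2) has_real_derivative 2 * w / x) (at x)"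
    unfolding w_def using x b
    by (auto intro!: derivative_eq_intros simp: field_simps power2_eq_square)
  show "((\<lambda>x. ln (mcKay_I_density b c m x)) has_real_derivative g x) (at x)"
  proof -
    let ?C = mcKay_I_const
    have eq: "ln (mcKay_I_density b c m y)
        = ln ?C + 2 * m * ln y - c * y / b + ln (bessel_phi m ((y / (2 * b))\<^sup>2))" if "y \<in> {0<..}" for y
    proof -
      have "bessel_phi m ((y / (2 * b))\<^sup>2) > 0"
        using m by (intro bessel_phi_pos) auto
      moreover have "y > 0" using that by simp
      ultimately show ?thesis
        using mcKay_I_const_pos by (simp add: mcKay_I_density_eq ln_mult ln_powr)
    qed
    have "((\<lambda>y. bessel_phi m ((y / (2 * b))\<^sup>2)) has_real_derivative bessel_phi (m + 1) w * (2 * w / x)) (at x)"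
      using DERIV_chain2[OF bessel_phi_deriv dw, of m] by (simp add: w_def)
    then have "((\<lambda>y. ln (bessel_phi m ((y / (2 * b))\<^sup>2))) has_real_derivative
        1 / bessel_phi m w * (bessel_phi (m + 1) w * (2 * w / x))) (at x)"
      using pos unfolding w_def
      by (intro DERIV_chain2[where f = ln] DERIV_ln_divide)
    moreover have "((\<lambda>y. ln ?C + 2 * m * ln y - c * y / b) has_real_derivative 2 * m / x - c / b) (at x)"
      using x b by (auto intro!: derivative_eq_intros)
    ultimately have "((\<lambda>y. ln ?C + 2 * m * ln y - c * y / b + ln (bessel_phi m ((y / (2 * b))\<^sup>2)))
        has_real_derivative 2 * m / x - c / b
          + 1 / bessel_phi m w * (bessel_phi (m + 1) w * (2 * w / x))) (at x)"
      by (rule DERIV_add[rotated])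
    also have "2 * m / x - c / b + 1 / bessel_phi m w * (bessel_phi (m + 1) w * (2 * w / x)) = g x"
      unfolding g_def bessel_ratio_def w_def [symmetric] by (simp add: add_divide_distrib mult_ac)
    finally show ?thesis
      by (rule has_field_derivative_transform_within_open[where S = "{0<..}"])
        (use eq x in auto)
  qed
  show "(g has_real_derivative 2 * curvature m ((x / (2 * b))\<^sup>2) / x\<^sup>2) (at x)"
  proof -
    define r where "r = bessel_ratio m w"
    \<comment> \<open>This is the x-derivative of the ratio, given by the Riccati equation and dw/dx
      = 2 w / x.\<close>
    define e where "e = (w - r\<^sup>2 - m * r) / w * (2 * w / x)"
    have ex: "e * x = 2 * (w - r\<^sup>2 - m * r)"
      using x w by (simp add: e_def)
    have "m > -1" using m by simp
    then have dr: "((\<lambda>y. bessel_ratio m ((y / (2 * b))\<^sup>2)) has_real_derivative e) (at x)"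
      using w dw unfolding r_def w_def e_def
      by (intro DERIV_chain2[where f = "bessel_ratio m"] bessel_ratio_deriv)
    have "(g has_real_derivative (2 * (e * x) - (2 * m + 2 * r)) / (x * x)) (at x)"
      unfolding g_def using x
      by (auto intro!: derivative_eq_intros dr simp: w_def [symmetric] r_def [symmetric])
    also have "(2 * (e * x) - (2 * m + 2 * r)) / (x * x) = 2 * curvature m w / x\<^sup>2"
      unfolding ex curvature_def r_def [symmetric] by (simp add: power2_eq_square algebra_simps)
    finally show ?thesis unfolding w_def .
  qed
qed

text \<open>The map from x to (x / (2 b))^2 sends the positive reals onto themselves. The predicate
  \<open>P\<close>, invariant under positive scaling, stands for either sign condition.\<close>

lemma ball_curvature_iff:
  assumes P: "\<And>x y. y > 0 \<Longrightarrow> P (2 * x / y) \<longleftrightarrow> P x"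
  shows "(\<forall>x\<in>{0<..}. P (2 * curvature m ((x / (2 * b))\<^sup>2) / x\<^sup>2)) \<longleftrightarrow> (\<forall>w>0. P (curvature m w))"
    (is "?L \<longleftrightarrow> ?R")
proof
  assume L: ?L
  show ?R
  proof (intro allI impI)
    fix w :: real assume "w > 0"
    define x where "x = 2 * b * sqrt w"
    have "x > 0" "(x / (2 * b))\<^sup>2 = w" using \<open>w > 0\<close> b by (simp_all add: x_def)
    then show "P (curvature m w)" using L[rule_format, of x] P[of "x\<^sup>2"] by simp
  qed
next
  assume R: ?R
  show ?L
  proof
    fix x :: real assume "x \<in> {0<..}"
    then have "x\<^sup>2 > 0" "(x / (2 * b))\<^sup>2 > 0" using b by simp_all
    then show "P (2 * curvature m ((x / (2 * b))\<^sup>2) / x\<^sup>2)"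
      unfolding P[OF \<open>x\<^sup>2 > 0\<close>] using R by blast
  qed
qed

lemma log_convex_on_mcKay_I_density_iff:
  "log_convex_on {0<..} (mcKay_I_density b c m) \<longleftrightarrow> (\<forall>w>0. curvature m w \<ge> 0)"
proof -
  have "log_convex_on {0<..} (mcKay_I_density b c m)
      \<longleftrightarrow> convex_on {0<..} (\<lambda>x. ln (mcKay_I_density b c m x))"
    by (rule log_convex_on_iff) (auto simp: mcKay_I_density_pos is_interval_convex_1)
  also have "\<dots> \<longleftrightarrow> (\<forall>x\<in>{0<..}. 2 * curvature m ((x / (2 * b))\<^sup>2) / x\<^sup>2 \<ge> 0)"
    by (rule convex_on_iff_second_deriv_nonneg[OF _ _ ln_mcKay_I_density_derivs]) auto
  also have "\<dots> \<longleftrightarrow> (\<forall>w>0. curvature m w \<ge> 0)"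
    by (rule ball_curvature_iff) (auto simp: zero_le_divide_iff)
  finally show ?thesis .
qed

lemma log_concave_on_mcKay_I_density_iff:
  "log_concave_on {0<..} (mcKay_I_density b c m) \<longleftrightarrow> (\<forall>w>0. curvature m w \<le> 0)"
proof -
  have "log_concave_on {0<..} (mcKay_I_density b c m)
      \<longleftrightarrow> concave_on {0<..} (\<lambda>x. ln (mcKay_I_density b c m x))"
    by (rule log_concave_on_iff) (auto simp: mcKay_I_density_pos is_interval_convex_1)
  also have "\<dots> \<longleftrightarrow> (\<forall>x\<in>{0<..}. 2 * curvature m ((x / (2 * b))\<^sup>2) / x\<^sup>2 \<le> 0)"
    by (rule concave_on_iff_second_deriv_nonpos[OF _ _ ln_mcKay_I_density_derivs]) auto
  also have "\<dots> \<longleftrightarrow> (\<forall>w>0. curvature m w \<le> 0)"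
    by (rule ball_curvature_iff) (auto simp: divide_le_0_iff)
  finally show ?thesis .
qed

end

theorem corollary2p8:
  fixes b c m :: real
  assumes "b > 0" and "c > 1" and "m > - 1 / 2"
  shows "(log_convex_on {0<..} (mcKay_I_density b c m) \<longleftrightarrow> m \<le> 0) \<and>
         (log_concave_on {0<..} (mcKay_I_density b c m) \<longleftrightarrow> m \<ge> 1 / 2)"
proof
  have "(\<forall>w>0. curvature m w \<ge> 0) \<longleftrightarrow> m \<le> 0"
  proof
    assume *: "\<forall>w>0. curvature m w \<ge> 0"
    show "m \<le> 0"
    proof (rule ccontr)
      assume "\<not> m \<le> 0"
      \<comment> \<open>The bound 1 is an arbitrary positive choice.\<close>
      then obtain v where "0 < v" "curvature m v < 0"
        using curvature_neg_near_0[of m 1] by auto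
      with * show False by force
    qed
  qed (use assms in \<open>auto intro: curvature_nonneg\<close>)
  then show "log_convex_on {0<..} (mcKay_I_density b c m) \<longleftrightarrow> m \<le> 0"
    by (simp only: log_convex_on_mcKay_I_density_iff[OF assms])
  have "(\<forall>w>0. curvature m w \<le> 0) \<longleftrightarrow> m \<ge> 1 / 2"
  proof
    assume *: "\<forall>w>0. curvature m w \<le> 0"
    show "m \<ge> 1 / 2"
    proof (rule ccontr)
      assume "\<not> m \<ge> 1 / 2"
      then obtain w where "w > 0" "curvature m w > 0"
        using curvature_pos_somewhere[of m] assms by auto
      with * show False by force
    qed
  qed (auto intro!: less_imp_le[OF curvature_neg])
  then show "log_concave_on {0<..} (mcKay_I_density b c m) \<longleftrightarrow> m \<ge> 1 / 2"
    by (simp only: log_concave_on_mcKay_I_density_iff[OF assms])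
qed

end
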